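(* Assume that the weight distribution has stretched exponential left tails, i.e. there are $p,\rho>0$ and $b>0$ such that $F(w)=p\exp(-w^{-\rho})$ for all $0<w\le b$. Let $k\ge0$, let $v_s=v_{s,k}$ be the scaling parameter defined in the context, and let $\sigma_s:=s v_s$. Then $$0<\liminf_{s\uparrow\infty}\frac{\sigma_s}{\log(s)^{1+1/\rho}}\le\limsup_{s\uparrow\infty}\frac{\sigma_s}{\log(s)^{1+1/\rho}}<\infty.$$
   Context: Let $a\ge0$ and $\alpha>1$. The weight $W$ is a random variable on $(0,\infty)$ with distribution function $F$, where $1-F$ is regularly varying at infinity with tail index $\beta>a\alpha$ (i.e. $1-F(w)=w^{-\beta}\ell(w)$, $\ell$ slowly varying). Let $h(w):=w\,\mathbb E[\mathbf 1\{W\ge w\}W^a]+w^a\,\mathbb E[\mathbf 1\{W<w\}W]$. The parameter $v_{s,k}$ is the largest solution $v$ of $k!=s\,\mathbb E\big[(s v\,h(W))^k\exp(-s v\,h(W))\big]$ (it exists for all sufficiently large $s$). *)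

theory Defs
  imports "HOL-Probability.Probability"
begin

definition slowly_varying :: "(real \<Rightarrow> real) \<Rightarrow> bool" where
  "slowly_varying l \<longleftrightarrow>
     l \<in> borel_measurable borel \<and>
     (\<forall>x>0. 0 < l x) \<and>
     (\<forall>c>0. ((\<lambda>x. l (c * x) / l x) \<longlongrightarrow> 1) at_top)"

definition regularly_varying_tail :: "(real \<Rightarrow> real) \<Rightarrow> real \<Rightarrow> bool" where
  "regularly_varying_tail F \<beta> \<longleftrightarrow>
     (\<exists>l. slowly_varying l \<and> (\<forall>w>0. 1 - F w = w powr (- \<beta>) * l w))"

definition weight_h :: "'a measure \<Rightarrow> ('a \<Rightarrow> real) \<Rightarrow> real \<Rightarrow> real \<Rightarrow> real" where
  "weight_h M W a w =
     w * (\<integral>\<omega>. indicator {\<omega>. W \<omega> \<ge> w} \<omega> * W \<omega> powr a \<partial>M) +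
     w powr a * (\<integral>\<omega>. indicator {\<omega>. W \<omega> < w} \<omega> * W \<omega> \<partial>M)"

text \<open>The largest solution of the defining equation. It exists for all sufficiently large \<open>s\<close>;
  for the remaining \<open>s\<close> the value is unspecified. No sign restriction on \<open>v\<close> is needed:
  when the expectation diverges (possible only for \<open>v < 0\<close>), the Bochner integral is \<open>0\<close>,
  which never solves the equation.\<close>

definition scaling_v :: "'a measure \<Rightarrow> ('a \<Rightarrow> real) \<Rightarrow> real \<Rightarrow> nat \<Rightarrow> real \<Rightarrow> real" where
  "scaling_v M W a k s =
     (GREATEST v. fact k =
        s * (\<integral>\<omega>. (s * v * weight_h M W a (W \<omega>)) ^ k * exp (- (s * v * weight_h M W a (W \<omega>))) \<partial>M))"

definition scaling_sigma :: "'a measure \<Rightarrow> ('a \<Rightarrow> real) \<Rightarrow> real \<Rightarrow> nat \<Rightarrow> real \<Rightarrow> real" where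
  "scaling_sigma M W a k s = s * scaling_v M W a k s"

end

theory Submission
  imports Defs "HOL-Real_Asymp.Real_Asymp"
begin

text \<open>
  Since \<open>h w\<close> is the expectation of \<open>min w W * max w W powr a\<close>, it is comparable to \<open>w\<close> near \<open>0\<close> and
  bounded away from \<open>0\<close> elsewhere; regular variation enters only through \<open>E (W powr a) < \<infinity>\<close> and the
  positivity of the tail. Put \<open>L = ln s\<close> and let \<open>G x\<close> be the expectation of \<open>(x h(W))^k exp(- x h(W))\<close>,
  so that \<open>\<sigma>\<close> is the largest root of \<open>s G = k!\<close>. The points \<open>(B L) powr (- 1 / \<rho>)\<close> have distribution
  function \<open>p s powr (- B)\<close>. If \<open>x \<ge> C L powr (1 + 1 / \<rho>)\<close> with \<open>C\<close> large, the event below the point with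
  \<open>B = 2\<close> and the exponential above it each contribute \<open>O(s powr (- 2))\<close>, hence \<open>s G x < k!\<close>.
  If \<open>x = c L powr (1 + 1 / \<rho>)\<close> with \<open>c\<close> small, weights between the points with \<open>B = 1/2\<close> and \<open>B = 1/4\<close>
  alone give \<open>s G x\<close> at least of order \<open>s powr (1/2)\<close>, hence \<open>s G x > k!\<close>. Continuity of \<open>G\<close> then puts the
  largest root between the two values of \<open>x\<close>.
\<close>

section \<open>Largest solutions of a level equation, and bounds for
  \<open>x ^ k * exp (- x)\<close>\<close>

text \<open>The intermediate value theorem gives a root in \<open>{x0..x1}\<close>, and the roots
  there form a compact set, which has a maximum. Any root outside this interval lies to the left of
  \<open>x0\<close>, so the maximum dominates all real roots although continuity is only assumed on
  \<open>{x0..}\<close>.\<close>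

lemma greatest_level_point:
  fixes f :: "real \<Rightarrow> real"
  assumes cont: "continuous_on {x0..} f" and ge: "y < f x0" and lt: "\<And>x. x1 \<le> x \<Longrightarrow> f x < y"
  obtains x where "x0 \<le> x" "x \<le> x1" "f x = y" "\<And>z. f z = y \<Longrightarrow> z \<le> x"
proof -
  have "x0 < x1"
    using ge lt[of x0] by force
  have cont': "continuous_on {x0..x1} f"
    using cont by (rule continuous_on_subset) auto
  define S where "S = {x \<in> {x0..x1}. f x = y}"
  have "S \<noteq> {}"
    using IVT2'[of f x1 y x0] ge lt[of x1] \<open>x0 < x1\<close> cont' unfolding S_def by force
  moreover have "compact S"
  proof -
    have "closed S"
      unfolding S_def using cont' by (intro continuous_closed_preimage_constant) auto
    moreover have "bounded S"
      by (rule bounded_subset[OF bounded_closed_interval[of x0 x1]]) (auto simp: S_def)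
    ultimately show ?thesis
      by (simp add: compact_eq_bounded_closed)
  qed
  ultimately obtain x where x: "x \<in> S" "\<And>z. z \<in> S \<Longrightarrow> z \<le> x"
    using compact_attains_sup by metis
  have "z \<le> x" if "f z = y" for z
    using x lt[of z] that by (cases "z < x0") (force simp: S_def)+
  with x show ?thesis
    by (intro that[of x]) (auto simp: S_def)
qed

lemma power_le_fact_exp:
  fixes x :: real
  assumes "0 \<le> x"
  shows "x ^ k \<le> fact k * exp x"
proof -
  have "(\<Sum>n\<in>{k}. x ^ n /\<^sub>R fact n) \<le> exp x"
    unfolding exp_def by (rule sum_le_suminf[OF summable_exp_generic]) (use assms in auto)
  then show ?thesis
    by (simp add: field_simps)
qed

lemma power_times_exp_le:
  fixes x :: real
  assumes "0 \<le> x"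
  shows "x ^ k * exp (- x) \<le> fact k"
proof -
  have "x ^ k * exp (- x) \<le> (fact k * exp x) * exp (- x)"
    using assms by (intro mult_right_mono power_le_fact_exp) auto
  then show ?thesis
    by (simp add: mult.assoc flip: exp_add)
qed

text \<open>One half of the exponential absorbs the power, by the previous bound at
  \<open>x / 2\<close>; the other half keeps the decay.\<close>

lemma power_times_exp_le_exp_half:
  fixes x :: real
  assumes "0 \<le> x"
  shows "x ^ k * exp (- x) \<le> fact k * 2 ^ k * exp (- x / 2)"
proof -
  have "x ^ k * exp (- x) = 2 ^ k * ((x / 2) ^ k * exp (- (x / 2))) * exp (- x / 2)"
    by (simp add: power_divide mult.assoc flip: exp_add)
  also have "\<dots> \<le> 2 ^ k * fact k * exp (- x / 2)"
    using assms by (intro mult_right_mono mult_left_mono power_times_exp_le) auto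
  finally show ?thesis
    by (simp add: mult_ac)
qed

section \<open>The transform of a nonnegative random variable\<close>

context prob_space
begin

lemma prob_gt_eq_cdf:
  assumes [measurable]: "X \<in> borel_measurable M"
  shows "prob {\<omega> \<in> space M. x < X \<omega>} = 1 - cdf (distr M borel X) x"
proof -
  have "cdf (distr M borel X) x = prob {\<omega> \<in> space M. X \<omega> \<le> x}"
    by (simp add: cdf_def2 measure_distr vimage_def Int_def conj_commute)
  moreover have "prob {\<omega> \<in> space M. \<not> X \<omega> \<le> x} = 1 - prob {\<omega> \<in> space M. X \<omega> \<le> x}"
    by (rule prob_neg) measurable
  ultimately show ?thesis
    by (simp add: not_le)
qed

text \<open>Dominated convergence: for nonnegative arguments the integrand never exceeds the
  constant \<open>fact k\<close>, uniformly in \<open>x\<close>.\<close>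

lemma continuous_on_power_exp_transform:
  fixes H :: "'a \<Rightarrow> real"
  assumes [measurable]: "H \<in> borel_measurable M" and nonneg: "AE \<omega> in M. 0 \<le> H \<omega>"
  shows "continuous_on {0..} (\<lambda>x. \<integral>\<omega>. (x * H \<omega>) ^ k * exp (- (x * H \<omega>)) \<partial>M)"
proof (rule continuous_on_sequentiallyI)
  fix u :: "nat \<Rightarrow> real" and x assume u: "\<forall>n. u n \<in> {0..}" "x \<in> {0..}" "u \<longlonglongrightarrow> x"
  show "(\<lambda>n. \<integral>\<omega>. (u n * H \<omega>) ^ k * exp (- (u n * H \<omega>)) \<partial>M)
          \<longlonglongrightarrow> (\<integral>\<omega>. (x * H \<omega>) ^ k * exp (- (x * H \<omega>)) \<partial>M)"
  proof (rule integral_dominated_convergence[where w = "\<lambda>_. fact k"])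
    show "AE \<omega> in M. (\<lambda>n. (u n * H \<omega>) ^ k * exp (- (u n * H \<omega>)))
            \<longlonglongrightarrow> (x * H \<omega>) ^ k * exp (- (x * H \<omega>))"
      using u by (intro AE_I2 tendsto_intros)
    fix n
    show "AE \<omega> in M. norm ((u n * H \<omega>) ^ k * exp (- (u n * H \<omega>))) \<le> fact k"
      using nonneg by eventually_elim (use u in \<open>simp add: power_times_exp_le\<close>)
  qed auto
qed


lemma integrable_power_exp:
  fixes H :: "'a \<Rightarrow> real"
  assumes [measurable]: "H \<in> borel_measurable M" and "AE \<omega> in M. 0 \<le> H \<omega>" and "0 \<le> x"
  shows "integrable M (\<lambda>\<omega>. (x * H \<omega>) ^ k * exp (- (x * H \<omega>)))"
proof (rule integrable_const_bound[of _ "fact k"])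
  show "AE \<omega> in M. norm ((x * H \<omega>) ^ k * exp (- (x * H \<omega>))) \<le> fact k"
    using assms(2) by eventually_elim (use \<open>0 \<le> x\<close> in \<open>simp add: power_times_exp_le\<close>)
qed auto

text \<open>The integrand is at most \<open>fact k * 2 ^ k\<close> times
  \<open>exp (- (x * H \<omega>) / 2)\<close>. This exponential is at most \<open>1\<close> on the
  exceptional event \<open>A\<close> and at most \<open>exp (- y / 2)\<close> off it.\<close>

lemma power_exp_transform_le:
  fixes H :: "'a \<Rightarrow> real"
  assumes [measurable]: "H \<in> borel_measurable M" "A \<in> events"
    and nonneg: "AE \<omega> in M. 0 \<le> H \<omega>" and "0 \<le> x"
    and ge: "AE \<omega> in M. \<omega> \<notin> A \<longrightarrow> y \<le> x * H \<omega>"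
  shows "(\<integral>\<omega>. (x * H \<omega>) ^ k * exp (- (x * H \<omega>)) \<partial>M) \<le> fact k * 2 ^ k * (prob A + exp (- y / 2))"
proof -
  have int: "integrable M (\<lambda>\<omega>. indicator A \<omega> :: real)"
    by (intro integrable_real_indicator) (auto simp: emeasure_eq_measure)
  have "(\<integral>\<omega>. (x * H \<omega>) ^ k * exp (- (x * H \<omega>)) \<partial>M)
      \<le> (\<integral>\<omega>. fact k * 2 ^ k * (indicator A \<omega> + exp (- y / 2)) \<partial>M)"
  proof (rule integral_mono_AE)
    show "AE \<omega> in M. (x * H \<omega>) ^ k * exp (- (x * H \<omega>))
        \<le> fact k * 2 ^ k * (indicator A \<omega> + exp (- y / 2))"
      using nonneg ge
    proof eventually_elim
      case (elim \<omega>)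
      then have "0 \<le> x * H \<omega>"
        using \<open>0 \<le> x\<close> by simp
      then have "(x * H \<omega>) ^ k * exp (- (x * H \<omega>)) \<le> fact k * 2 ^ k * exp (- (x * H \<omega>) / 2)"
        by (rule power_times_exp_le_exp_half)
      also have "exp (- (x * H \<omega>) / 2) \<le> indicator A \<omega> + exp (- y / 2)"
        using elim \<open>0 \<le> x * H \<omega>\<close> by (cases "\<omega> \<in> A") (auto intro: add_increasing2)
      finally show ?case
        by simp
    qed
  qed (use nonneg \<open>0 \<le> x\<close> int in \<open>auto intro!: integrable_power_exp\<close>)
  also have "\<dots> = fact k * 2 ^ k * (prob A + exp (- y / 2))"
    using int by (simp add: prob_space)
  finally show ?thesis .
qed

text \<open>Discard everything outside \<open>A\<close>. On \<open>A\<close> the lower bound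
  \<open>1\<close> makes the power at least \<open>1\<close> for every \<open>k\<close>, and the
  upper bound \<open>y\<close> controls the exponential.\<close>

lemma power_exp_transform_ge:
  fixes H :: "'a \<Rightarrow> real"
  assumes [measurable]: "H \<in> borel_measurable M" "A \<in> events"
    and nonneg: "AE \<omega> in M. 0 \<le> H \<omega>" and "0 \<le> x"
    and ge: "\<And>\<omega>. \<omega> \<in> A \<Longrightarrow> 1 \<le> x * H \<omega>" and le: "\<And>\<omega>. \<omega> \<in> A \<Longrightarrow> x * H \<omega> \<le> y"
  shows "exp (- y) * prob A \<le> (\<integral>\<omega>. (x * H \<omega>) ^ k * exp (- (x * H \<omega>)) \<partial>M)"
proof -
  have int: "integrable M (\<lambda>\<omega>. indicator A \<omega> :: real)"
    by (intro integrable_real_indicator) (auto simp: emeasure_eq_measure)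
  have "exp (- y) * prob A = (\<integral>\<omega>. exp (- y) * indicator A \<omega> \<partial>M)"
    by simp
  also have "\<dots> \<le> (\<integral>\<omega>. (x * H \<omega>) ^ k * exp (- (x * H \<omega>)) \<partial>M)"
  proof (rule integral_mono_AE)
    show "AE \<omega> in M. exp (- y) * indicator A \<omega> \<le> (x * H \<omega>) ^ k * exp (- (x * H \<omega>))"
      using nonneg
    proof eventually_elim
      case (elim \<omega>)
      show ?case
      proof (cases "\<omega> \<in> A")
        case True
        have "1 * exp (- y) \<le> (x * H \<omega>) ^ k * exp (- (x * H \<omega>))"
          using ge[OF True] le[OF True] by (intro mult_mono) auto
        with True show ?thesis
          by simp
      qed (use elim \<open>0 \<le> x\<close> in simp)
    qed
  qed (use nonneg \<open>0 \<le> x\<close> int in \<open>auto intro!: integrable_power_exp\<close>)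
  finally show ?thesis .
qed

section \<open>Moments from a regularly varying tail\<close>

text \<open>Slow variation at the single ratio \<open>2\<close> suffices: each doubling far out
  shrinks the tail by a fixed factor, so a dyadic decomposition bounds the moment by a geometric
  series.\<close>

lemma integrable_powr_of_regularly_varying_tail:
  assumes [measurable]: "X \<in> borel_measurable M" and pos: "AE \<omega> in M. 0 < X \<omega>"
    and "0 \<le> a" "a < \<beta>" and tail: "regularly_varying_tail (cdf (distr M borel X)) \<beta>"
  shows "integrable M (\<lambda>\<omega>. X \<omega> powr a)"
proof -
  define T where "T x = prob {\<omega> \<in> space M. x < X \<omega>}" for x
  obtain l where l: "slowly_varying l" "\<And>w. 0 < w \<Longrightarrow> T w = w powr (- \<beta>) * l w"
    using tail unfolding regularly_varying_tail_def T_def by (auto simp: prob_gt_eq_cdf)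
  have lpos: "0 < l x" if "0 < x" for x
    using l(1) that by (auto simp: slowly_varying_def)
  \<comment> \<open>Any exponent strictly between \<open>a\<close> and \<open>\<beta>\<close> would
    do: the gap to \<open>\<beta>\<close> absorbs the fluctuation of \<open>l\<close>, and the gap
    to \<open>a\<close> makes the ratio \<open>2 powr a * r\<close> smaller than
    \<open>1\<close>.\<close>
  define \<gamma> where "\<gamma> = (a + \<beta>) / 2"
  have "a < \<gamma>" "\<gamma> < \<beta>"
    using \<open>a < \<beta>\<close> by (auto simp: \<gamma>_def field_simps)
  define r :: real where "r = 2 powr (- \<gamma>)"
  have "((\<lambda>x. l (2 * x) / l x) \<longlongrightarrow> 1) at_top"
    using l(1) by (simp add: slowly_varying_def)
  moreover have "1 < (2::real) powr (\<beta> - \<gamma>)"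
    using \<open>\<gamma> < \<beta>\<close> by simp
  ultimately have "\<forall>\<^sub>F x in at_top. l (2 * x) / l x < 2 powr (\<beta> - \<gamma>)"
    by (rule order_tendstoD)
  then obtain x0 where x0: "\<And>x. x0 \<le> x \<Longrightarrow> l (2 * x) / l x < 2 powr (\<beta> - \<gamma>)"
    by (auto simp: eventually_at_top_linorder)
  define y where "y = max 1 x0"
  have "1 \<le> y"
    by (simp add: y_def)
  have T_double: "T (2 * x) \<le> r * T x" if "y \<le> x" for x
  proof -
    have "0 < x" "l (2 * x) \<le> 2 powr (\<beta> - \<gamma>) * l x"
      using x0[of x] lpos[of x] that by (auto simp: y_def field_simps)
    then have "T (2 * x) \<le> (2 * x) powr (- \<beta>) * (2 powr (\<beta> - \<gamma>) * l x)"
      by (simp add: l mult_left_mono)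
    also have "\<dots> = r * T x"
      using \<open>0 < x\<close> by (simp add: l r_def powr_mult powr_diff powr_minus field_simps)
    finally show ?thesis .
  qed
  have T_dyadic: "T (2 ^ n * y) \<le> r ^ n" for n
  proof (induction n)
    case 0
    show ?case
      by (simp add: T_def)
  next
    case (Suc n)
    have "y \<le> 2 ^ n * y"
      using \<open>1 \<le> y\<close> by simp
    then have "T (2 ^ Suc n * y) \<le> r * T (2 ^ n * y)"
      using T_double by (simp add: mult.assoc)
    also have "\<dots> \<le> r * r ^ n"
      using Suc.IH by (intro mult_left_mono) (auto simp: r_def)
    finally show ?case
      by simp
  qed
  \<comment> \<open>The value of \<open>X \<omega> powr a\<close> at the right end of the layer from
    \<open>2 ^ n * y\<close> to \<open>2 ^ Suc n * y\<close>, in geometric form.\<close>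
  define c where "c n = (2 * y) powr a * (2 powr a) ^ n" for n :: nat
  have c: "(2 ^ Suc n * y) powr a = c n" for n
    using \<open>1 \<le> y\<close> by (simp add: c_def powr_mult powr_power powr_powr mult_ac flip: powr_realpow)
  \<comment> \<open>Whole tail events replace the disjoint layers. Overcounting is harmless, and
    their probabilities are directly those bounded by \<open>T_dyadic\<close>.\<close>
  have pointwise: "ennreal (X \<omega> powr a)
      \<le> ennreal (y powr a) + (\<Sum>n. ennreal (c n) * indicator {\<omega> \<in> space M. 2 ^ n * y < X \<omega>} \<omega>)"
    (is "_ \<le> _ + (\<Sum>n. ?f n)")
    if "0 < X \<omega>" "\<omega> \<in> space M" for \<omega>
  proof (cases "X \<omega> \<le> y")
    case True
    then have "X \<omega> powr a \<le> y powr a"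
      using that \<open>0 \<le> a\<close> by (intro powr_mono2) auto
    then show ?thesis
      by (intro add_increasing2) (auto simp: ennreal_leI)
  next
    case False
    obtain n0 where "X \<omega> / y < 2 ^ n0"
      using real_arch_pow[of 2 "X \<omega> / y"] by auto
    then have ex: "X \<omega> \<le> 2 ^ n0 * y"
      using \<open>1 \<le> y\<close> by (simp add: field_simps)
    \<comment> \<open>Minimality places \<open>X \<omega>\<close> in the layer ending at
      \<open>2 ^ m * y\<close>; \<open>m\<close> is not \<open>0\<close> because
      \<open>X \<omega>\<close> exceeds \<open>y\<close>.\<close>
    define m where "m = (LEAST n. X \<omega> \<le> 2 ^ n * y)"
    have m: "X \<omega> \<le> 2 ^ m * y"
      unfolding m_def using ex by (rule LeastI)
    with False obtain n where n: "m = Suc n"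
      by (cases m) auto
    define g where "g n = ?f n" for n
    have "2 ^ n * y < X \<omega>"
      using not_less_Least[of n "\<lambda>n. X \<omega> \<le> 2 ^ n * y"] n by (simp add: m_def)
    then have "g n = ennreal (c n)"
      using that by (simp add: g_def)
    moreover have "g n \<le> suminf g"
      using sum_le_suminf[of g "{n}"] by simp
    moreover have "X \<omega> powr a \<le> c n"
      unfolding c[symmetric] using m n that \<open>0 \<le> a\<close> by (intro powr_mono2) auto
    ultimately show ?thesis
      unfolding g_def[abs_def] by (intro add_increasing) (auto intro: order_trans ennreal_leI)
  qed
  have "2 powr a * r < 1"
    using \<open>a < \<gamma>\<close> powr_less_mono[of "a - \<gamma>" 0 2] by (simp add: r_def flip: powr_add)
  have "(\<integral>\<^sup>+\<omega>. ennreal (X \<omega> powr a) \<partial>M)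
      \<le> (\<integral>\<^sup>+\<omega>. ennreal (y powr a)
          + (\<Sum>n. ennreal (c n) * indicator {\<omega> \<in> space M. 2 ^ n * y < X \<omega>} \<omega>) \<partial>M)"
    by (rule nn_integral_mono_AE) (use pos pointwise AE_space in auto)
  also have "\<dots> = ennreal (y powr a) + (\<Sum>n. ennreal (c n) * ennreal (T (2 ^ n * y)))"
    by (simp add: nn_integral_add nn_integral_suminf nn_integral_cmult_indicator
        T_def emeasure_eq_measure prob_space)
  also have "\<dots> \<le> ennreal (y powr a) + (\<Sum>n. ennreal ((2 * y) powr a * (2 powr a * r) ^ n))"
  proof (intro add_left_mono suminf_le)
    fix n
    have "c n * T (2 ^ n * y) \<le> c n * r ^ n"
      by (intro mult_left_mono T_dyadic) (auto simp: c_def)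
    then show "ennreal (c n) * ennreal (T (2 ^ n * y)) \<le> ennreal ((2 * y) powr a * (2 powr a * r) ^ n)"
      by (simp add: c_def T_def power_mult_distrib mult_ac ennreal_leI flip: ennreal_mult)
  qed auto
  also have "\<dots> < \<infinity>"
  proof -
    have "summable (\<lambda>n. (2 * y) powr a * (2 powr a * r) ^ n)"
      using \<open>2 powr a * r < 1\<close> by (intro summable_mult summable_geometric) (simp add: r_def)
    then have "(\<Sum>n. ennreal ((2 * y) powr a * (2 powr a * r) ^ n))
        = ennreal (\<Sum>n. (2 * y) powr a * (2 powr a * r) ^ n)"
      by (intro suminf_ennreal2) (simp_all add: r_def)
    then show ?thesis
      by simp
  qed
  finally show ?thesis
    by (intro integrableI_bounded) auto
qed

end

section \<open>Linear bounds for \<open>weight_h\<close> near zero\<close>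

locale positive_weight = prob_space M for M :: "'a measure" +
  fixes W :: "'a \<Rightarrow> real" and a :: real
  assumes W_measurable [measurable]: "W \<in> borel_measurable M"
    and W_pos: "AE \<omega> in M. 0 < W \<omega>"
    and a_nonneg: "0 \<le> a"
    and integrable_W_powr: "integrable M (\<lambda>\<omega>. W \<omega> powr a)"
begin

lemma integrable_upper_powr: "integrable M (\<lambda>\<omega>. indicator {\<omega>. W \<omega> \<ge> w} \<omega> * W \<omega> powr a)"
  by (rule Bochner_Integration.integrable_bound[OF integrable_W_powr])
    (auto simp: indicator_def)

text \<open>The truncation itself bounds the integrand by \<open>\<bar>w\<bar>\<close>. This matters
  for \<open>a < 1\<close>, where \<open>W\<close> may have infinite mean.\<close>

lemma integrable_truncated: "integrable M (\<lambda>\<omega>. indicator {\<omega>. W \<omega> < w} \<omega> * W \<omega>)"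
proof (rule Bochner_Integration.integrable_bound[of M "\<lambda>_. \<bar>w\<bar>"])
  show "AE \<omega> in M. norm (indicator {\<omega>. W \<omega> < w} \<omega> * W \<omega>) \<le> norm \<bar>w\<bar>"
    using W_pos by eventually_elim (auto simp: indicator_def)
qed auto

lemma borel_measurable_weight_h [measurable]: "weight_h M W a \<in> borel_measurable borel"
  unfolding weight_h_def by measurable

text \<open>The first summand is at most \<open>w\<close> times the full moment; the second is at
  most \<open>w powr a * w\<close>, and \<open>w powr a \<le> b powr a\<close>.\<close>

lemma weight_h_upper:
  assumes "0 < w" "w \<le> b"
  shows "weight_h M W a w \<le> (expectation (\<lambda>\<omega>. W \<omega> powr a) + b powr a) * w"
proof -
  have "(\<integral>\<omega>. indicator {\<omega>. W \<omega> \<ge> w} \<omega> * W \<omega> powr a \<partial>M) \<le> expectation (\<lambda>\<omega>. W \<omega> powr a)"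
    by (intro integral_mono integrable_upper_powr integrable_W_powr) (auto simp: indicator_def)
  moreover have "(\<integral>\<omega>. indicator {\<omega>. W \<omega> < w} \<omega> * W \<omega> \<partial>M) \<le> expectation (\<lambda>_. w)"
    using assms by (intro integral_mono integrable_truncated) (auto simp: indicator_def)
  moreover have "w powr a \<le> b powr a"
    using assms a_nonneg by (intro powr_mono2) auto
  ultimately have "weight_h M W a w \<le> w * expectation (\<lambda>\<omega>. W \<omega> powr a) + b powr a * w"
    unfolding weight_h_def using assms
    by (intro add_mono mult_mono mult_left_mono integral_nonneg_AE)
      (use W_pos in \<open>auto simp: prob_space\<close>)
  then show ?thesis
    by (simp add: algebra_simps)
qed

text \<open>Only outcomes with \<open>W \<omega> \<ge> b\<close> are kept, and the comparison is
  pointwise. If \<open>w \<le> W \<omega>\<close>, the first summand suffices; if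
  \<open>b \<le> W \<omega> < w\<close>, the minimum is \<open>b\<close> and the second summand
  suffices.\<close>

lemma weight_h_lower:
  assumes "0 < w" "0 < b"
  shows "(\<integral>\<omega>. indicator {\<omega>. W \<omega> \<ge> b} \<omega> * W \<omega> powr a \<partial>M) * min w b \<le> weight_h M W a w"
proof -
  have "(\<integral>\<omega>. indicator {\<omega>. W \<omega> \<ge> b} \<omega> * W \<omega> powr a \<partial>M) * min w b
      = (\<integral>\<omega>. min w b * (indicator {\<omega>. W \<omega> \<ge> b} \<omega> * W \<omega> powr a) \<partial>M)"
    by simp
  also have "\<dots> \<le> (\<integral>\<omega>. w * (indicator {\<omega>. W \<omega> \<ge> w} \<omega> * W \<omega> powr a)
      + w powr a * (indicator {\<omega>. W \<omega> < w} \<omega> * W \<omega>) \<partial>M)"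
  proof (rule integral_mono_AE)
    show "AE \<omega> in M. min w b * (indicator {\<omega>. W \<omega> \<ge> b} \<omega> * W \<omega> powr a)
        \<le> w * (indicator {\<omega>. W \<omega> \<ge> w} \<omega> * W \<omega> powr a)
          + w powr a * (indicator {\<omega>. W \<omega> < w} \<omega> * W \<omega>)"
      using W_pos
    proof eventually_elim
      case (elim \<omega>)
      have "b * W \<omega> powr a \<le> W \<omega> * w powr a" if "b \<le> W \<omega>" "W \<omega> < w"
        using that elim assms a_nonneg by (intro mult_mono powr_mono2) auto
      then show ?case
        using elim assms by (auto simp: indicator_def min_def mult_ac intro!: mult_right_mono)
    qed
  qed (intro integrable_mult_right Bochner_Integration.integrable_add
      integrable_upper_powr integrable_truncated)+
  also have "\<dots> = weight_h M W a w"
    unfolding weight_h_def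
    by (subst Bochner_Integration.integral_add)
      (simp_all add: integrable_upper_powr integrable_truncated)
  finally show ?thesis .
qed

lemma upper_moment_pos:
  assumes "0 < b" "0 < prob {\<omega> \<in> space M. b < W \<omega>}"
  shows "0 < (\<integral>\<omega>. indicator {\<omega>. W \<omega> \<ge> b} \<omega> * W \<omega> powr a \<partial>M)"
proof -
  have "0 < b powr a * prob {\<omega> \<in> space M. b < W \<omega>}"
    using assms by simp
  also have "\<dots> = (\<integral>\<omega>. b powr a * indicator {\<omega> \<in> space M. b < W \<omega>} \<omega> \<partial>M)"
    by simp
  also have "\<dots> \<le> (\<integral>\<omega>. indicator {\<omega>. W \<omega> \<ge> b} \<omega> * W \<omega> powr a \<partial>M)"
  proof (rule integral_mono)
    show "integrable M (\<lambda>\<omega>. b powr a * indicator {\<omega> \<in> space M. b < W \<omega>} \<omega>)"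
      by (intro integrable_mult_right integrable_real_indicator) (auto simp: emeasure_eq_measure)
    show "b powr a * indicator {\<omega> \<in> space M. b < W \<omega>} \<omega> \<le> indicator {\<omega>. W \<omega> \<ge> b} \<omega> * W \<omega> powr a"
      for \<omega>
      using assms a_nonneg by (auto simp: indicator_def intro!: powr_mono2)
  qed (rule integrable_upper_powr)
  finally show ?thesis .
qed

end

section \<open>Stretched exponential left tails and the critical scale\<close>

locale stretched_exponential_weight = positive_weight +
  fixes p \<rho> b :: real
  assumes p_pos: "0 < p" and \<rho>_pos: "0 < \<rho>" and b_pos: "0 < b"
    and prob_W_gt_pos: "0 < prob {\<omega> \<in> space M. b < W \<omega>}"
    and cdf_W: "\<And>w. 0 < w \<Longrightarrow> w \<le> b \<Longrightarrow> cdf (distr M borel W) w = p * exp (- (w powr (- \<rho>)))"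
begin

text \<open>The function \<open>G\<close>, in the variable \<open>x = s * v\<close>: the equation
  for \<open>scaling_v\<close> becomes \<open>s * transform k x = fact k\<close>, with
  \<open>s\<close> only as a prefactor.\<close>

definition transform :: "nat \<Rightarrow> real \<Rightarrow> real" where
  "transform k x =
     (\<integral>\<omega>. (x * weight_h M W a (W \<omega>)) ^ k * exp (- (x * weight_h M W a (W \<omega>))) \<partial>M)"

text \<open>The inverse of \<open>w powr (- \<rho>)\<close>, hence the point where the distribution
  function equals \<open>p * exp (- y)\<close>, provided it is at most \<open>b\<close>. It
  decreases in \<open>y\<close>.\<close>

definition quantile :: "real \<Rightarrow> real" where
  "quantile y = y powr (- (1 / \<rho>))"

lemma quantile_pos: "0 < y \<Longrightarrow> 0 < quantile y"
  by (simp add: quantile_def)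

lemma quantile_antimono: "0 < y \<Longrightarrow> y \<le> z \<Longrightarrow> quantile z \<le> quantile y"
  unfolding quantile_def using \<rho>_pos by (intro powr_mono2') auto

lemma eventually_quantile_le_b:
  assumes "0 < B"
  shows "\<forall>\<^sub>F s in at_top. quantile (B * ln s) \<le> b"
proof -
  have "((\<lambda>s. quantile (B * ln s)) \<longlongrightarrow> 0) at_top"
    unfolding quantile_def using assms \<rho>_pos by real_asymp
  then have "\<forall>\<^sub>F s in at_top. quantile (B * ln s) < b"
    using b_pos by (rule order_tendstoD)
  then show ?thesis
    by eventually_elim simp
qed

lemma prob_le_quantile:
  assumes "0 < y" "quantile y \<le> b"
  shows "prob {\<omega> \<in> space M. W \<omega> \<le> quantile y} = p * exp (- y)"
proof -
  have "prob {\<omega> \<in> space M. W \<omega> \<le> quantile y} = cdf (distr M borel W) (quantile y)"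
    by (simp add: cdf_def2 measure_distr vimage_def Int_def conj_commute)
  also have "\<dots> = p * exp (- (quantile y powr (- \<rho>)))"
    using assms quantile_pos by (intro cdf_W)
  also have "quantile y powr (- \<rho>) = y"
    using assms \<rho>_pos by (simp add: quantile_def powr_powr)
  finally show ?thesis .
qed

text \<open>The source of the exponent \<open>1 + 1 / \<rho>\<close>: with \<open>L = ln s\<close>,
  the product of \<open>x\<close> and a weight at a quantile is linear in \<open>ln s\<close>, so
  its exponential is a power of \<open>s\<close>.\<close>

lemma powr_times_quantile:
  assumes "0 < L" "0 < B"
  shows "L powr (1 + 1 / \<rho>) * quantile (B * L) = quantile B * L"
  using assms by (simp add: quantile_def powr_add powr_mult powr_minus field_simps)

definition lower_slope :: real where
  "lower_slope = (\<integral>\<omega>. indicator {\<omega>. W \<omega> \<ge> b} \<omega> * W \<omega> powr a \<partial>M)"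

definition upper_slope :: real where
  "upper_slope = expectation (\<lambda>\<omega>. W \<omega> powr a) + b powr a"

lemma lower_slope_pos: "0 < lower_slope"
  unfolding lower_slope_def using b_pos prob_W_gt_pos by (rule upper_moment_pos)

lemma upper_slope_pos: "0 < upper_slope"
  unfolding upper_slope_def using b_pos by (intro add_nonneg_pos integral_nonneg_AE) auto

text \<open>A substitute for monotonicity of \<open>weight_h\<close>: one bound covers all weights
  above \<open>v\<close>, including those beyond \<open>b\<close>.\<close>

lemma weight_h_ge:
  assumes "0 < v" "v \<le> b" "v \<le> w"
  shows "lower_slope * v \<le> weight_h M W a w"
proof -
  have "lower_slope * v \<le> lower_slope * min w b"
    using assms lower_slope_pos by (intro mult_left_mono) auto
  also have "\<dots> \<le> weight_h M W a w"
    unfolding lower_slope_def using assms by (intro weight_h_lower) auto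
  finally show ?thesis .
qed

lemma weight_h_nonneg: "0 < w \<Longrightarrow> 0 \<le> weight_h M W a w"
  using weight_h_ge[of "min w b" w] lower_slope_pos b_pos
  by (smt (verit) mult_nonneg_nonneg min.cobounded1 min.cobounded2 min_less_iff_conj)

lemma AE_weight_h_nonneg: "AE \<omega> in M. 0 \<le> weight_h M W a (W \<omega>)"
  using W_pos by eventually_elim (rule weight_h_nonneg)

lemma continuous_on_transform: "continuous_on {0..} (transform k)"
  unfolding transform_def[abs_def]
  by (rule continuous_on_power_exp_transform) (auto intro: AE_weight_h_nonneg)

section \<open>The transform on either side of the critical scale\<close>

text \<open>The bound is uniform over all larger \<open>x\<close>, which is what excludes roots to
  the right.\<close>

lemma eventually_transform_small:
  obtains C where "0 < C"
    "\<forall>\<^sub>F s in at_top. \<forall>x \<ge> C * ln s powr (1 + 1 / \<rho>). s * transform k x < fact k"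
proof
  \<comment> \<open>Chosen so that \<open>x\<close> times \<open>weight_h\<close> is at least
    \<open>4 * ln s\<close> above \<open>quantile (2 * ln s)\<close>. After the halving in
    \<open>power_exp_transform_le\<close> the exponential is \<open>1 / s ^ 2\<close>, matching the
    order of the probability below that quantile.\<close>
  define C where "C = 4 / (lower_slope * quantile 2)"
  have q2: "0 < quantile 2"
    by (simp add: quantile_pos)
  show "0 < C"
    using lower_slope_pos q2 by (simp add: C_def)
  show "\<forall>\<^sub>F s in at_top. \<forall>x \<ge> C * ln s powr (1 + 1 / \<rho>). s * transform k x < fact k"
    using eventually_quantile_le_b[of 2, simplified] eventually_gt_at_top[of 1]
      eventually_gt_at_top[of "2 ^ k * (p + 1)"]
  proof eventually_elim
    case (elim s)
    show ?case
    proof (intro allI impI)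
      fix x assume x: "C * ln s powr (1 + 1 / \<rho>) \<le> x"
      define w where "w = quantile (2 * ln s)"
      have "0 < ln s" "0 < w" "w \<le> b"
        using elim by (auto simp: w_def quantile_pos)
      have "0 \<le> x"
        using x \<open>0 < C\<close> by (smt (verit) mult_nonneg_nonneg powr_ge_zero)
      have "4 * ln s = C * ln s powr (1 + 1 / \<rho>) * (lower_slope * w)"
        using powr_times_quantile[of "ln s" 2] \<open>0 < ln s\<close> lower_slope_pos q2
        by (simp add: C_def w_def field_simps)
      also have "\<dots> \<le> x * (lower_slope * w)"
        using x lower_slope_pos \<open>0 < w\<close> by (intro mult_right_mono) auto
      finally have *: "4 * ln s \<le> x * (lower_slope * w)" .
      have exp_2: "exp (- (2 * ln s)) = 1 / s ^ 2"
        using elim by (simp add: exp_minus exp_double divide_inverse)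
      have "transform k x \<le> fact k * 2 ^ k * (prob {\<omega> \<in> space M. W \<omega> \<le> w} + exp (- (4 * ln s) / 2))"
        unfolding transform_def
      proof (rule power_exp_transform_le)
        show "AE \<omega> in M. \<omega> \<notin> {\<omega> \<in> space M. W \<omega> \<le> w} \<longrightarrow> 4 * ln s \<le> x * weight_h M W a (W \<omega>)"
          using AE_space
        proof eventually_elim
          case (elim \<omega>)
          show ?case
          proof
            assume "\<omega> \<notin> {\<omega> \<in> space M. W \<omega> \<le> w}"
            then have "lower_slope * w \<le> weight_h M W a (W \<omega>)"
              using elim \<open>0 < w\<close> \<open>w \<le> b\<close> by (intro weight_h_ge) auto
            then show "4 * ln s \<le> x * weight_h M W a (W \<omega>)"
              using * \<open>0 \<le> x\<close> by (meson mult_left_mono order_trans)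
          qed
        qed
      qed (use AE_weight_h_nonneg \<open>0 \<le> x\<close> in auto)
      also have "\<dots> = fact k * 2 ^ k * (p + 1) / s ^ 2"
      proof -
        have "prob {\<omega> \<in> space M. W \<omega> \<le> w} = p * (1 / s ^ 2)"
          unfolding exp_2[symmetric] w_def
          using \<open>0 < ln s\<close> \<open>w \<le> b\<close> by (intro prob_le_quantile) (auto simp: w_def)
        moreover have "exp (- (4 * ln s) / 2) = 1 / s ^ 2"
          unfolding exp_2[symmetric] by simp
        ultimately show ?thesis
          by (simp only: add_divide_distrib distrib_left) simp
      qed
      finally have "s * transform k x \<le> s * (fact k * 2 ^ k * (p + 1) / s ^ 2)"
        using elim by (intro mult_left_mono) auto
      also have "\<dots> = fact k * (2 ^ k * (p + 1) / s)"
        using elim by (simp add: power2_eq_square field_simps)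
      \<comment> \<open>Here the threshold \<open>2 ^ k * (p + 1)\<close> imposed on
        \<open>s\<close> enters.\<close>
      also have "\<dots> < fact k * 1"
        using elim by (intro mult_strict_left_mono) auto
      finally show "s * transform k x < fact k"
        by simp
    qed
  qed
qed

text \<open>Weights between two quantiles suffice: the upper one keeps the exponential from being
  too small, and the lower one makes the base of the power at least \<open>1\<close>.\<close>

lemma eventually_transform_large:
  obtains c where "0 < c"
    "\<forall>\<^sub>F s in at_top. fact k < s * transform k (c * ln s powr (1 + 1 / \<rho>))"
proof
  \<comment> \<open>Normalised so that \<open>x * (upper_slope * w0) = ln s / 4\<close> at the upper
    point \<open>w0 = quantile (1 / 4 * ln s)\<close>.\<close>
  define c where "c = 1 / (4 * upper_slope * quantile (1 / 4))"
  have q: "0 < quantile (1 / 4)" "0 < quantile (1 / 2)"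
    by (simp_all add: quantile_pos)
  show "0 < c"
    using upper_slope_pos q by (simp add: c_def)
  have "0 < c * lower_slope * quantile (1 / 2)"
    using \<open>0 < c\<close> lower_slope_pos q by simp
  then have "filterlim (\<lambda>s. c * lower_slope * quantile (1 / 2) * ln s) at_top at_top"
    by (intro filterlim_tendsto_pos_mult_at_top[OF tendsto_const _ ln_at_top])
  then have ev1: "\<forall>\<^sub>F s in at_top. 1 \<le> c * lower_slope * quantile (1 / 2) * ln s"
    by (rule filterlim_at_top[THEN iffD1, rule_format])
  \<comment> \<open>The factors \<open>exp (- (ln s / 4))\<close> from the integrand and from the
    probability cost \<open>s powr (1 / 2)\<close> together, so growth of order
    \<open>s powr (1 / 2)\<close> remains.\<close>
  have "filterlim (\<lambda>s. s * (exp (- (ln s / 4)) * (p * exp (- (ln s / 4)) - p * exp (- (ln s / 2)))))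
          at_top at_top"
    using p_pos by real_asymp
  then have ev2: "\<forall>\<^sub>F s in at_top.
      fact k < s * (exp (- (ln s / 4)) * (p * exp (- (ln s / 4)) - p * exp (- (ln s / 2))))"
    by (rule filterlim_at_top_dense[THEN iffD1, rule_format])
  show "\<forall>\<^sub>F s in at_top. fact k < s * transform k (c * ln s powr (1 + 1 / \<rho>))"
    using eventually_quantile_le_b[of "1 / 4", simplified] eventually_gt_at_top[of 1] ev1 ev2
  proof eventually_elim
    case (elim s)
    define x where "x = c * ln s powr (1 + 1 / \<rho>)"
    define w0 where "w0 = quantile (1 / 4 * ln s)"
    define w1 where "w1 = quantile (1 / 2 * ln s)"
    have "0 < ln s" "0 \<le> x"
      using elim \<open>0 < c\<close> by (auto simp: x_def)
    have w: "0 < w1" "w1 \<le> w0" "w0 \<le> b"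
      using elim \<open>0 < ln s\<close> by (auto simp: w0_def w1_def quantile_pos intro!: quantile_antimono)
    have up: "x * (upper_slope * w0) = ln s / 4"
      using powr_times_quantile[of "ln s" "1 / 4"] \<open>0 < ln s\<close> upper_slope_pos q
      by (simp add: x_def c_def w0_def field_simps)
    have "x * (lower_slope * w1) = c * lower_slope * (ln s powr (1 + 1 / \<rho>) * w1)"
      by (simp add: x_def mult_ac)
    also have "\<dots> = c * lower_slope * quantile (1 / 2) * ln s"
      unfolding w1_def using \<open>0 < ln s\<close> by (subst powr_times_quantile) auto
    finally have low: "1 \<le> x * (lower_slope * w1)"
      using elim by (simp only:)
    have diff: "{\<omega> \<in> space M. w1 < W \<omega> \<and> W \<omega> \<le> w0}
        = {\<omega> \<in> space M. W \<omega> \<le> w0} - {\<omega> \<in> space M. W \<omega> \<le> w1}"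
      by auto
    have "prob {\<omega> \<in> space M. W \<omega> \<le> w0} = p * exp (- (1 / 4 * ln s))"
      using w \<open>0 < ln s\<close> unfolding w0_def by (intro prob_le_quantile) auto
    moreover have "prob {\<omega> \<in> space M. W \<omega> \<le> w1} = p * exp (- (1 / 2 * ln s))"
      using w \<open>0 < ln s\<close> unfolding w1_def by (intro prob_le_quantile) auto
    moreover have "prob ({\<omega> \<in> space M. W \<omega> \<le> w0} - {\<omega> \<in> space M. W \<omega> \<le> w1})
        = prob {\<omega> \<in> space M. W \<omega> \<le> w0} - prob {\<omega> \<in> space M. W \<omega> \<le> w1}"
    proof (rule finite_measure_Diff)
      show "{\<omega> \<in> space M. W \<omega> \<le> w1} \<subseteq> {\<omega> \<in> space M. W \<omega> \<le> w0}"
        using w(2) by force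
    qed measurable
    ultimately have prob: "prob {\<omega> \<in> space M. w1 < W \<omega> \<and> W \<omega> \<le> w0}
        = p * exp (- (ln s / 4)) - p * exp (- (ln s / 2))"
      unfolding diff by simp
    have "exp (- (ln s / 4)) * prob {\<omega> \<in> space M. w1 < W \<omega> \<and> W \<omega> \<le> w0} \<le> transform k x"
      unfolding transform_def
    proof (rule power_exp_transform_ge)
      fix \<omega> assume "\<omega> \<in> {\<omega> \<in> space M. w1 < W \<omega> \<and> W \<omega> \<le> w0}"
      then have \<omega>: "w1 < W \<omega>" "W \<omega> \<le> w0"
        by auto
      have "lower_slope * w1 \<le> weight_h M W a (W \<omega>)"
        using \<omega> w by (intro weight_h_ge) auto
      then show "1 \<le> x * weight_h M W a (W \<omega>)"
        using low \<open>0 \<le> x\<close> by (meson mult_left_mono order_trans)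
      have "weight_h M W a (W \<omega>) \<le> upper_slope * W \<omega>"
        unfolding upper_slope_def using \<omega> w by (intro weight_h_upper) auto
      also have "\<dots> \<le> upper_slope * w0"
        using \<omega> upper_slope_pos by (intro mult_left_mono) auto
      finally show "x * weight_h M W a (W \<omega>) \<le> ln s / 4"
        unfolding up[symmetric] using \<open>0 \<le> x\<close> by (intro mult_left_mono)
    qed (use AE_weight_h_nonneg \<open>0 \<le> x\<close> in auto)
    then have "s * (exp (- (ln s / 4)) * (p * exp (- (ln s / 4)) - p * exp (- (ln s / 2))))
        \<le> s * transform k x"
      using elim unfolding prob by (intro mult_left_mono) auto
    with elim(4) show ?case
      unfolding x_def by (rule less_le_trans)
  qed
qed

section \<open>Locating the largest root\<close>

text \<open>For \<open>s > 0\<close> the substitution \<open>x = s * v\<close> preserves order, so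
  the largest root in \<open>x\<close> yields the largest in \<open>v\<close>. Negative
  \<open>v\<close> are covered because \<open>greatest_level_point\<close> compares with all real
  roots.\<close>

lemma scaling_sigma_between:
  assumes "0 < s" "0 \<le> x0" and large: "fact k < s * transform k x0"
    and small: "\<And>x. x1 \<le> x \<Longrightarrow> s * transform k x < fact k"
  shows "scaling_sigma M W a k s \<in> {x0..x1}"
proof -
  have "continuous_on {x0..} (\<lambda>x. s * transform k x)"
    using \<open>0 \<le> x0\<close>
    by (intro continuous_on_mult_left continuous_on_subset[OF continuous_on_transform]) auto
  then obtain x where x: "x0 \<le> x" "x \<le> x1" "s * transform k x = fact k"
      "\<And>z. s * transform k z = fact k \<Longrightarrow> z \<le> x"
    using greatest_level_point[of x0 "\<lambda>x. s * transform k x" "fact k" x1] large small by blast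
  have "scaling_v M W a k s = (GREATEST v. fact k = s * transform k (s * v))"
    by (simp add: scaling_v_def transform_def mult.assoc)
  also have "\<dots> = x / s"
  proof (rule Greatest_equality)
    show "fact k = s * transform k (s * (x / s))"
      using x(3) \<open>0 < s\<close> by simp
    show "v \<le> x / s" if "fact k = s * transform k (s * v)" for v
      using x(4)[of "s * v"] that \<open>0 < s\<close> by (simp add: field_simps)
  qed
  finally show ?thesis
    using x \<open>0 < s\<close> by (simp add: scaling_sigma_def)
qed

lemma scaling_sigma_ratio_bounds:
  obtains c C where "0 < c"
    "\<forall>\<^sub>F s in at_top. scaling_sigma M W a k s / ln s powr (1 + 1 / \<rho>) \<in> {c..C}"
proof -
  obtain c where c: "0 < c"
    "\<forall>\<^sub>F s in at_top. fact k < s * transform k (c * ln s powr (1 + 1 / \<rho>))"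
    by (rule eventually_transform_large)
  obtain C where C:
    "\<forall>\<^sub>F s in at_top. \<forall>x \<ge> C * ln s powr (1 + 1 / \<rho>). s * transform k x < fact k"
    by (rule eventually_transform_small)
  have "\<forall>\<^sub>F s in at_top. scaling_sigma M W a k s / ln s powr (1 + 1 / \<rho>) \<in> {c..C}"
    using c(2) C eventually_gt_at_top[of 1]
  proof eventually_elim
    case (elim s)
    have "scaling_sigma M W a k s \<in> {c * ln s powr (1 + 1 / \<rho>)..C * ln s powr (1 + 1 / \<rho>)}"
      using elim \<open>0 < c\<close> by (intro scaling_sigma_between) auto
    then show ?case
      using elim by (simp add: field_simps)
  qed
  with c(1) show ?thesis
    by (rule that)
qed

end

theorem lemma3p3:
  fixes M :: "'a measure" and W :: "'a \<Rightarrow> real"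
    and a \<alpha> \<beta> p \<rho> b :: real and k :: nat
  assumes "prob_space M"
    and "W \<in> borel_measurable M"
    and "AE \<omega> in M. 0 < W \<omega>"
    and "0 \<le> a" and "1 < \<alpha>" and "a * \<alpha> < \<beta>"
    and "regularly_varying_tail (cdf (distr M borel W)) \<beta>"
    and "0 < p" and "0 < \<rho>" and "0 < b"
    and "\<And>w. 0 < w \<Longrightarrow> w \<le> b \<Longrightarrow>
           cdf (distr M borel W) w = p * exp (- (w powr (- \<rho>)))"
  shows "0 < Liminf at_top (\<lambda>s. ereal (scaling_sigma M W a k s / ln s powr (1 + 1 / \<rho>))) \<and>
         Liminf at_top (\<lambda>s. ereal (scaling_sigma M W a k s / ln s powr (1 + 1 / \<rho>)))
           \<le> Limsup at_top (\<lambda>s. ereal (scaling_sigma M W a k s / ln s powr (1 + 1 / \<rho>))) \<and>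
         Limsup at_top (\<lambda>s. ereal (scaling_sigma M W a k s / ln s powr (1 + 1 / \<rho>))) < \<infinity>"
proof -
  interpret prob_space M
    by fact
  \<comment> \<open>This reduces \<open>a * \<alpha> < \<beta>\<close> to the condition
    \<open>a < \<beta>\<close> of the moment lemma.\<close>
  have "a \<le> a * \<alpha>"
    using assms(4,5) by (simp add: mult_le_cancel_left1)
  then have "integrable M (\<lambda>\<omega>. W \<omega> powr a)"
    using assms by (intro integrable_powr_of_regularly_varying_tail) auto
  \<comment> \<open>Positivity of the slowly varying factor at \<open>b\<close> gives mass beyond
    \<open>b\<close>, hence a positive \<open>lower_slope\<close>.\<close>
  moreover have "0 < prob {\<omega> \<in> space M. b < W \<omega>}"
  proof -
    obtain l where "slowly_varying l" "1 - cdf (distr M borel W) b = b powr (- \<beta>) * l b"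
      using assms(7) \<open>0 < b\<close> by (auto simp: regularly_varying_tail_def)
    with assms(2) \<open>0 < b\<close> show ?thesis
      by (simp add: prob_gt_eq_cdf slowly_varying_def)
  qed
  ultimately interpret stretched_exponential_weight M W a p \<rho> b
    using assms by unfold_locales auto
  let ?f = "\<lambda>s. ereal (scaling_sigma M W a k s / ln s powr (1 + 1 / \<rho>))"
  obtain c C where "0 < c" and ev:
    "\<forall>\<^sub>F s in at_top. scaling_sigma M W a k s / ln s powr (1 + 1 / \<rho>) \<in> {c..C}"
    by (rule scaling_sigma_ratio_bounds)
  have "ereal c \<le> Liminf at_top ?f"
    using ev by (intro Liminf_bounded) (auto elim: eventually_mono)
  moreover have "Limsup at_top ?f \<le> ereal C"
    using ev by (intro Limsup_bounded) (auto elim: eventually_mono)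
  moreover have "Liminf at_top ?f \<le> Limsup at_top ?f"
    by (intro Liminf_le_Limsup) simp
  ultimately show ?thesis
    using \<open>0 < c\<close> by (auto intro: less_le_trans[of 0 "ereal c"] le_less_trans[of _ "ereal C"])
qed

end
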